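(* Let $p > 5$ be a (rational integer) prime and let $i^2=-1$. Then $$S_p = \sum_{\substack{1 \leq n, m \leq p-1 \\ \gcd(p,\, m^2+n^2)=1}} \frac{1}{n+mi} \equiv 0 \pmod{p^4},$$ where the sum is over all pairs of integers $(n,m)$ with $1\le n,m\le p-1$ and $m^2+n^2$ not divisible by $p$.
   Context: The sum is computed in $\mathbb{Q}(i)$. Every summand has denominator whose norm $n^2+m^2$ is coprime to $p$, so the sum lies in the ring $R=\{a/b : a\in\mathbb{Z}[i],\ b\in\mathbb{Z},\ p\nmid b\}$. For $x,y\in R$, the congruence $x\equiv y \pmod{p^k}$ means $x-y\in p^kR$, i.e. $x-y=p^k a/b$ with $a\in\mathbb{Z}[i]$, $b\in\mathbb{Z}$, $p\nmid b$. *)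

theory Defs
  imports Complex_Main "HOL-Computational_Algebra.Primes"
begin

text \<open>The field $\mathbb{Q}(i)$ is taken as a subfield of the type \<^typ>\<open>complex\<close>, so the
  sets below are sets of complex numbers.\<close>

definition gauss_ints :: "complex set" where
  "gauss_ints = {of_int x + of_int y * \<i> | x y :: int. True}"

definition gauss_local :: "int \<Rightarrow> complex set" where
  "gauss_local p = {a / of_int b | (a :: complex) (b :: int). a \<in> gauss_ints \<and> \<not> p dvd b}"

text \<open>Congruence modulo $p^k$ in the ring \<^term>\<open>gauss_local p\<close>. Membership of both sides in
  that ring is part of the relation.\<close>

definition gauss_cong :: "int \<Rightarrow> nat \<Rightarrow> complex \<Rightarrow> complex \<Rightarrow> bool" where
  "gauss_cong p k x y \<longleftrightarrow>
     x \<in> gauss_local p \<and> y \<in> gauss_local p \<and>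
     (\<exists>z \<in> gauss_local p. x - y = of_int p ^ k * z)"

definition gauss_recip_sum :: "int \<Rightarrow> complex" where
  "gauss_recip_sum p =
     (\<Sum>(n, m) \<in> {(n, m). 1 \<le> n \<and> n \<le> p - 1 \<and> 1 \<le> m \<and> m \<le> p - 1 \<and> gcd p (m\<^sup>2 + n\<^sup>2) = 1}.
        1 / (of_int n + of_int m * \<i>))"

end

(* The quarter turn z -> i z + p about the centre p(1+i)/2 permutes the index set, and the reciprocals
   over an orbit add up to p^3 (i - 1) divided by the product of the orbit. So 4 S = p^3 (i - 1) B with
   B the sum of the reciprocal orbit products. Modulo p, these products are homogeneous of degree 4 in z
   and doubling permutes the index set, hence 16 B = B, and p divides B because 15 is prime to p. *)
theory Submission
  imports Defs
begin

section \<open>Gaussian integers and their localization at \<open>p\<close>\<close>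

lemma gauss_intsI: "z = of_int x + of_int y * \<i> \<Longrightarrow> z \<in> gauss_ints"
  unfolding gauss_ints_def by blast

lemma gauss_ints_add:
  assumes "a \<in> gauss_ints" "b \<in> gauss_ints"
  shows "a + b \<in> gauss_ints"
proof -
  obtain x y u v :: int where "a = of_int x + of_int y * \<i>" "b = of_int u + of_int v * \<i>"
    using assms unfolding gauss_ints_def by blast
  then show ?thesis
    by (intro gauss_intsI[of _ "x + u" "y + v"]) (simp add: algebra_simps)
qed

lemma gauss_ints_mult:
  assumes "a \<in> gauss_ints" "b \<in> gauss_ints"
  shows "a * b \<in> gauss_ints"
proof -
  obtain x y u v :: int where "a = of_int x + of_int y * \<i>" "b = of_int u + of_int v * \<i>"
    using assms unfolding gauss_ints_def by blast
  then show ?thesis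
    by (intro gauss_intsI[of _ "x * u - y * v" "x * v + y * u"]) (simp add: complex_eq_iff)
qed

lemma gauss_ints_of_int: "of_int x \<in> gauss_ints"
  by (rule gauss_intsI[of _ x 0]) simp

lemma gauss_localI: "a \<in> gauss_ints \<Longrightarrow> \<not> p dvd b \<Longrightarrow> a / of_int b \<in> gauss_local p"
  unfolding gauss_local_def by blast

context
  fixes p :: int
  assumes p: "prime p"
begin

lemma gauss_local_gauss_ints: "a \<in> gauss_ints \<Longrightarrow> a \<in> gauss_local p"
  using gauss_localI[of a p 1] p not_prime_unit by auto

lemma gauss_local_of_int: "of_int x \<in> gauss_local p"
  by (intro gauss_local_gauss_ints gauss_ints_of_int)

lemma gauss_local_numeral: "numeral k \<in> gauss_local p"
  using gauss_local_of_int[of "numeral k"] by simp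

lemma gauss_local_0: "0 \<in> gauss_local p"
  using gauss_local_of_int[of 0] by simp

lemma gauss_local_i: "\<i> \<in> gauss_local p"
  by (intro gauss_local_gauss_ints gauss_intsI[of _ 0 1]) simp

text \<open>Primality of \<open>p\<close> keeps the common denominator \<open>b * d\<close> prime to
  \<open>p\<close>; the same holds for products below.\<close>

lemma gauss_local_add:
  assumes "x \<in> gauss_local p" "y \<in> gauss_local p"
  shows "x + y \<in> gauss_local p"
proof -
  obtain a b c d where x: "x = a / of_int b" "a \<in> gauss_ints" "\<not> p dvd b"
    and y: "y = c / of_int d" "c \<in> gauss_ints" "\<not> p dvd d"
    using assms unfolding gauss_local_def by blast
  have "b \<noteq> 0" "d \<noteq> 0" "\<not> p dvd b * d"
    using x y p by (auto simp: prime_dvd_mult_iff)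
  moreover have "a * of_int d + c * of_int b \<in> gauss_ints"
    using x y by (intro gauss_ints_add gauss_ints_mult gauss_ints_of_int)
  moreover have "x + y = (a * of_int d + c * of_int b) / of_int (b * d)"
    using calculation x y by (simp add: field_simps)
  ultimately show ?thesis
    using gauss_localI by presburger
qed

lemma gauss_local_mult:
  assumes "x \<in> gauss_local p" "y \<in> gauss_local p"
  shows "x * y \<in> gauss_local p"
proof -
  obtain a b c d where x: "x = a / of_int b" "a \<in> gauss_ints" "\<not> p dvd b"
    and y: "y = c / of_int d" "c \<in> gauss_ints" "\<not> p dvd d"
    using assms unfolding gauss_local_def by blast
  have "\<not> p dvd b * d"
    using x y p by (auto simp: prime_dvd_mult_iff)
  moreover have "a * c \<in> gauss_ints"
    using x y by (intro gauss_ints_mult)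
  moreover have "x * y = (a * c) / of_int (b * d)"
    using x y by simp
  ultimately show ?thesis
    using gauss_localI by presburger
qed

lemma gauss_local_diff:
  assumes "x \<in> gauss_local p" "y \<in> gauss_local p"
  shows "x - y \<in> gauss_local p"
  using gauss_local_add[OF assms(1) gauss_local_mult[OF gauss_local_of_int[of "-1"] assms(2)]]
  by simp

lemma gauss_local_sum: "(\<And>k. k \<in> A \<Longrightarrow> f k \<in> gauss_local p) \<Longrightarrow> sum f A \<in> gauss_local p"
  by (induction A rule: infinite_finite_induct) (auto intro: gauss_local_0 gauss_local_add)

text \<open>Integers prime to \<open>p\<close> are units of the local ring. This is what later
  allows division by -15 and by 4.\<close>

lemma gauss_local_divide_int:
  assumes "x \<in> gauss_local p" "\<not> p dvd b"
  shows "x / of_int b \<in> gauss_local p"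
  using gauss_local_mult[OF assms(1) gauss_localI[OF gauss_ints_of_int[of 1] assms(2)]] by simp

text \<open>Multiplying by the conjugate turns the denominator into the norm
  \<open>n\<^sup>2 + m\<^sup>2\<close>, a rational integer prime to \<open>p\<close>.\<close>

lemma gauss_local_inverse:
  fixes n m :: int
  assumes "\<not> p dvd n\<^sup>2 + m\<^sup>2"
  defines "z \<equiv> of_int n + of_int m * \<i> :: complex"
  shows "z \<noteq> 0" and "1 / z \<in> gauss_local p"
proof -
  have "n\<^sup>2 + m\<^sup>2 \<noteq> 0"
    using assms by auto
  then have nz: "of_int (n\<^sup>2 + m\<^sup>2) \<noteq> (0 :: complex)"
    by (simp only: of_int_eq_0_iff) simp
  have norm: "z * (of_int n + of_int (- m) * \<i>) = of_int (n\<^sup>2 + m\<^sup>2)"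
    unfolding z_def by (simp add: complex_eq_iff power2_eq_square algebra_simps)
  show "z \<noteq> 0"
    using norm nz by auto
  have "1 / z = (of_int n + of_int (- m) * \<i>) / of_int (n\<^sup>2 + m\<^sup>2)"
    using frac_eq_eq[OF \<open>z \<noteq> 0\<close> nz] norm by (metis mult.commute mult_1)
  then show "1 / z \<in> gauss_local p"
    using gauss_localI[OF gauss_intsI[OF refl] assms(1)] by metis
qed

lemma gauss_cong_mult:
  assumes "gauss_cong p k x y" "gauss_cong p k u v"
  shows "gauss_cong p k (x * u) (y * v)"
proof -
  obtain s t where s: "s \<in> gauss_local p" "x - y = of_int p ^ k * s"
    and t: "t \<in> gauss_local p" "u - v = of_int p ^ k * t"
    using assms unfolding gauss_cong_def by blast
  have mem: "x \<in> gauss_local p" "y \<in> gauss_local p" "u \<in> gauss_local p" "v \<in> gauss_local p"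
    using assms unfolding gauss_cong_def by auto
  have "x * u - y * v = (x - y) * u + y * (u - v)"
    by (simp add: algebra_simps)
  also have "\<dots> = of_int p ^ k * (s * u + y * t)"
    unfolding s(2) t(2) by (simp add: algebra_simps)
  finally have "x * u - y * v = of_int p ^ k * (s * u + y * t)" .
  moreover have "s * u + y * t \<in> gauss_local p"
    using mem s t by (intro gauss_local_add gauss_local_mult)
  ultimately show ?thesis
    using mem gauss_local_mult unfolding gauss_cong_def by blast
qed

end

section \<open>The index set, the quarter turn and the doubling map\<close>

definition recip_index :: "int \<Rightarrow> (int \<times> int) set" where
  "recip_index p =
     {(n, m). 1 \<le> n \<and> n \<le> p - 1 \<and> 1 \<le> m \<and> m \<le> p - 1 \<and> gcd p (m\<^sup>2 + n\<^sup>2) = 1}"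

definition gauss_of :: "int \<times> int \<Rightarrow> complex" where
  "gauss_of = (\<lambda>(n, m). of_int n + of_int m * \<i>)"

text \<open>This is z -> iz + p in coordinates. The shift by p brings the coordinates back into the
  range 1 to p - 1, so the map is affine over Z[i] without reduction modulo p, and identities along
  an orbit are exact.\<close>

definition quarter_turn :: "int \<Rightarrow> int \<times> int \<Rightarrow> int \<times> int" where
  "quarter_turn p = (\<lambda>(n, m). (p - m, n))"

definition double_mod :: "int \<Rightarrow> int \<times> int \<Rightarrow> int \<times> int" where
  "double_mod p = (\<lambda>(n, m). (2 * n mod p, 2 * m mod p))"

text \<open>The factors are z, iz + p, -z + (1 + i)p and -iz + ip, so the product is congruent to
  -z^4 modulo p. A fourth quarter turn leads back to z.\<close>

definition orbit_prod :: "int \<Rightarrow> int \<times> int \<Rightarrow> complex" where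
  "orbit_prod p x = gauss_of x * gauss_of (quarter_turn p x) *
     gauss_of (quarter_turn p (quarter_turn p x)) *
     gauss_of (quarter_turn p (quarter_turn p (quarter_turn p x)))"

lemma finite_recip_index: "finite (recip_index p)"
proof (rule finite_subset)
  show "recip_index p \<subseteq> {1..p - 1} \<times> {1..p - 1}"
    by (auto simp: recip_index_def)
qed simp

lemma gauss_of_quarter_turn: "gauss_of (quarter_turn p x) = \<i> * gauss_of x + of_int p"
  by (cases x) (simp add: gauss_of_def quarter_turn_def algebra_simps)

lemma gauss_of_double_mod:
  obtains a where "a \<in> gauss_ints" "gauss_of (double_mod p x) = 2 * gauss_of x + of_int p * a"
proof -
  obtain n m where x: "x = (n, m)" by fastforce
  have mod: "of_int (2 * k mod p) = (2 * of_int k - of_int p * of_int (2 * k div p) :: complex)" for k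
    by (simp flip: minus_mult_div_eq_mod)
  show thesis
    \<comment> \<open>The coordinates of the witness are minus the integer quotients of the two
      divisions by \<open>p\<close>.\<close>
    by (rule that[OF gauss_intsI[OF refl, of "- (2 * n div p)" "- (2 * m div p)"]])
      (simp add: x gauss_of_def double_mod_def mod, simp add: algebra_simps)
qed

context
  fixes p :: int
  assumes p: "prime p"
begin

lemma recip_index_iff:
  "(n, m) \<in> recip_index p \<longleftrightarrow> n \<in> {1..p - 1} \<and> m \<in> {1..p - 1} \<and> \<not> p dvd n\<^sup>2 + m\<^sup>2"
proof -
  have "gcd p (m\<^sup>2 + n\<^sup>2) = 1 \<longleftrightarrow> \<not> p dvd n\<^sup>2 + m\<^sup>2"
    using p prime_imp_coprime[of p "m\<^sup>2 + n\<^sup>2"] coprime_absorb_left[of p "m\<^sup>2 + n\<^sup>2"]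
      not_prime_unit[of p]
    by (auto simp: coprime_iff_gcd_eq_1 add.commute)
  then show ?thesis
    by (auto simp: recip_index_def)
qed

lemma inverse_gauss_of:
  assumes "x \<in> recip_index p"
  shows "gauss_of x \<noteq> 0" "1 / gauss_of x \<in> gauss_local p"
proof -
  obtain n m where x: "x = (n, m)" by fastforce
  then have "\<not> p dvd n\<^sup>2 + m\<^sup>2"
    using assms by (simp add: recip_index_iff)
  from gauss_local_inverse[OF p this] show "gauss_of x \<noteq> 0" "1 / gauss_of x \<in> gauss_local p"
    by (simp_all add: x gauss_of_def)
qed

lemma gauss_of_local: "gauss_of x \<in> gauss_local p"
  by (cases x) (auto simp: gauss_of_def intro!: gauss_local_gauss_ints[OF p] gauss_intsI)

lemma quarter_turn_mem:
  assumes "x \<in> recip_index p"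
  shows "quarter_turn p x \<in> recip_index p"
proof -
  obtain n m where x: "x = (n, m)" by fastforce
  \<comment> \<open>The quarter turn changes the norm only by a multiple of
    \<open>p\<close>.\<close>
  have "(p - m)\<^sup>2 + n\<^sup>2 = (n\<^sup>2 + m\<^sup>2) + p * (p - 2 * m)"
    by (simp add: power2_eq_square algebra_simps)
  then have "p dvd (p - m)\<^sup>2 + n\<^sup>2 \<longleftrightarrow> p dvd n\<^sup>2 + m\<^sup>2"
    by (simp only: dvd_add_left_iff[OF dvd_triv_left])
  then show ?thesis
    using assms by (auto simp: x quarter_turn_def recip_index_iff)
qed

section \<open>Sums of reciprocals over orbits of the quarter turn\<close>

lemma sum_quarter_turn:
  fixes f :: "int \<times> int \<Rightarrow> complex"
  shows "(\<Sum>x\<in>recip_index p. f (quarter_turn p x)) = sum f (recip_index p)"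
proof (rule sum.reindex_bij_betw)
  \<comment> \<open>An injective map of a finite set into itself is a bijection.\<close>
  have "inj_on (quarter_turn p) (recip_index p)"
    by (auto simp: inj_on_def quarter_turn_def)
  then show "bij_betw (quarter_turn p) (recip_index p) (recip_index p)"
    unfolding bij_betw_def
    using endo_inj_surj[OF finite_recip_index] quarter_turn_mem by blast
qed

lemma inverse_orbit_prod:
  assumes "x \<in> recip_index p"
  shows "orbit_prod p x \<noteq> 0" "1 / orbit_prod p x \<in> gauss_local p"
proof -
  note mem = assms quarter_turn_mem[OF assms] quarter_turn_mem[OF quarter_turn_mem[OF assms]]
    quarter_turn_mem[OF quarter_turn_mem[OF quarter_turn_mem[OF assms]]]
  note inv = mem[THEN inverse_gauss_of(2)]
  show "orbit_prod p x \<noteq> 0"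
    using mem[THEN inverse_gauss_of(1)] by (simp add: orbit_prod_def)
  show "1 / orbit_prod p x \<in> gauss_local p"
    using gauss_local_mult[OF p gauss_local_mult[OF p gauss_local_mult[OF p inv(1,2)] inv(3)] inv(4)]
    by (simp add: orbit_prod_def)
qed

lemma gauss_recip_sum_orbit:
  "4 * gauss_recip_sum p = of_int p ^ 3 * (\<i> - 1) * (\<Sum>x\<in>recip_index p. 1 / orbit_prod p x)"
proof -
  let ?D = "recip_index p" and ?r = "quarter_turn p" and ?f = "\<lambda>x. 1 / gauss_of x"
  have S: "gauss_recip_sum p = sum ?f ?D"
    unfolding gauss_recip_sum_def recip_index_def gauss_of_def
    by (rule sum.cong) auto
  have orbit: "?f x + ?f (?r x) + ?f (?r (?r x)) + ?f (?r (?r (?r x))) =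
      of_int p ^ 3 * (\<i> - 1) * (1 / orbit_prod p x)" if "x \<in> ?D" for x
  proof -
    define a where "a = gauss_of x"
    define b where "b = gauss_of (?r x)"
    define c where "c = gauss_of (?r (?r x))"
    define d where "d = gauss_of (?r (?r (?r x)))"
    define q where "q = (of_int p :: complex)"
    have nz: "a \<noteq> 0" "b \<noteq> 0" "c \<noteq> 0" "d \<noteq> 0"
      unfolding a_def b_def c_def d_def
      by (intro inverse_gauss_of(1) quarter_turn_mem that)+
    have eq: "b = \<i> * a + q" "c = \<i> * b + q" "d = \<i> * c + q"
      unfolding a_def b_def c_def d_def q_def by (simp_all add: gauss_of_quarter_turn)
    \<comment> \<open>The left side is ac(b + d) + bd(a + c). Both \<open>a + c\<close> and
      \<open>b + d\<close> equal (1 + i)q, and ac + bd = iq^2, so all terms containing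
      \<open>a\<close> cancel and (1 + i)i q^3 = (i - 1)q^3 remains.\<close>
    have "b * c * d + a * c * d + a * b * d + a * b * c = q ^ 3 * (\<i> - 1)"
      unfolding eq using i_squared by algebra
    then have "1 / a + 1 / b + 1 / c + 1 / d = q ^ 3 * (\<i> - 1) * (1 / (a * b * c * d))"
      using nz by (simp add: divide_simps) (simp add: algebra_simps)
    then show ?thesis
      by (simp add: a_def b_def c_def d_def q_def orbit_prod_def)
  qed
  \<comment> \<open>Each of the four sums over rotated points equals the original one. Counting this
    way avoids choosing orbit representatives.\<close>
  have "4 * sum ?f ?D = (\<Sum>x\<in>?D. ?f x + ?f (?r x) + ?f (?r (?r x)) + ?f (?r (?r (?r x))))"
    using sum_quarter_turn[of ?f] sum_quarter_turn[of "\<lambda>x. ?f (?r x)"]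
      sum_quarter_turn[of "\<lambda>x. ?f (?r (?r x))"]
    by (simp add: sum.distrib)
  also have "\<dots> = (\<Sum>x\<in>?D. of_int p ^ 3 * (\<i> - 1) * (1 / orbit_prod p x))"
    by (rule sum.cong[OF refl orbit])
  finally show ?thesis
    by (simp only: S sum_distrib_left)
qed

section \<open>Doubling modulo \<open>p\<close>\<close>

lemma orbit_prod_double_mod:
  "gauss_cong p 1 (orbit_prod p (double_mod p x)) (16 * orbit_prod p x)"
proof -
  let ?r = "quarter_turn p"
  \<comment> \<open>Doubling commutes with the quarter turn modulo p: rotating 2z gives 2iz + p,
    while doubling the rotated point gives 2iz + 2p. Hence the congruence propagates along the
    orbit, and the four factors 2 multiply to 16.\<close>
  have step: "gauss_cong p 1 (gauss_of (?r y)) (2 * gauss_of (?r z))"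
    if yz: "gauss_cong p 1 (gauss_of y) (2 * gauss_of z)" for y z
  proof -
    obtain s where s: "s \<in> gauss_local p" "gauss_of y - 2 * gauss_of z = of_int p ^ 1 * s"
      using yz unfolding gauss_cong_def by blast
    have "gauss_of (?r y) - 2 * gauss_of (?r z) =
        \<i> * (gauss_of y - 2 * gauss_of z) - of_int p"
      by (simp add: gauss_of_quarter_turn algebra_simps)
    also have "\<dots> = of_int p ^ 1 * (\<i> * s - of_int 1)"
      unfolding s(2) by (simp add: algebra_simps)
    finally have "gauss_of (?r y) - 2 * gauss_of (?r z) = of_int p ^ 1 * (\<i> * s - of_int 1)" .
    moreover have "\<i> * s - of_int 1 \<in> gauss_local p"
      using s gauss_local_i[OF p] gauss_local_of_int[OF p]
      by (intro gauss_local_diff[OF p] gauss_local_mult[OF p])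
    ultimately show ?thesis
      unfolding gauss_cong_def
      using gauss_of_local gauss_local_mult[OF p gauss_local_numeral[OF p]] by blast
  qed
  obtain a where a: "a \<in> gauss_ints"
    "gauss_of (double_mod p x) = 2 * gauss_of x + of_int p * a"
    using gauss_of_double_mod .
  then have "gauss_of (double_mod p x) - 2 * gauss_of x = of_int p ^ 1 * a"
    by simp
  then have 0: "gauss_cong p 1 (gauss_of (double_mod p x)) (2 * gauss_of x)"
    unfolding gauss_cong_def
    using gauss_of_local gauss_local_mult[OF p gauss_local_numeral[OF p]]
      gauss_local_gauss_ints[OF p a(1)] by blast
  note 1 = step[OF 0] and 2 = step[OF step[OF 0]] and 3 = step[OF step[OF step[OF 0]]]
  show ?thesis
    using gauss_cong_mult[OF p gauss_cong_mult[OF p gauss_cong_mult[OF p 0 1] 2] 3]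
    by (simp add: orbit_prod_def algebra_simps)
qed

text \<open>Since 2 is a unit modulo an odd prime, doubling is injective on residues and keeps
  nonzero ones nonzero; it multiplies the norm by the unit 4. Finiteness then gives
  surjectivity.\<close>

lemma bij_double_mod:
  assumes "p > 2"
  shows "bij_betw (double_mod p) (recip_index p) (recip_index p)"
proof -
  have p2: "\<not> p dvd 2"
    using assms zdvd_imp_le[of p 2] by auto
  have two: "p dvd 2 * k \<longleftrightarrow> p dvd k" for k
    using p p2 by (auto simp: prime_dvd_mult_iff)
  have range: "2 * k mod p \<in> {1..p - 1}" if "k \<in> {1..p - 1}" for k
  proof -
    have "\<not> p dvd k"
      using that zdvd_imp_le[of p k] by auto
    then have "2 * k mod p \<noteq> 0"
      by (simp add: two flip: dvd_eq_mod_eq_0)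
    then have "0 < 2 * k mod p"
      using assms pos_mod_sign[of p "2 * k"] by linarith
    then show ?thesis
      using assms pos_mod_bound[of p "2 * k"] by auto
  qed
  have norm: "p dvd (2 * n mod p)\<^sup>2 + (2 * m mod p)\<^sup>2 \<longleftrightarrow> p dvd n\<^sup>2 + m\<^sup>2" for n m
  proof -
    have "((2 * n mod p)\<^sup>2 + (2 * m mod p)\<^sup>2) mod p = ((2 * n)\<^sup>2 + (2 * m)\<^sup>2) mod p"
      by (rule mod_add_cong; rule power_mod)
    \<comment> \<open>The factor 4 is split as 2 * 2 so that \<open>two\<close> cancels it in two
      rewrites.\<close>
    also have "(2 * n)\<^sup>2 + (2 * m)\<^sup>2 = 2 * (2 * (n\<^sup>2 + m\<^sup>2))"
      by (simp add: power2_eq_square)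
    finally have "p dvd (2 * n mod p)\<^sup>2 + (2 * m mod p)\<^sup>2 \<longleftrightarrow> p dvd 2 * (2 * (n\<^sup>2 + m\<^sup>2))"
      by (simp only: dvd_eq_mod_eq_0)
    then show ?thesis
      by (simp only: two)
  qed
  have inj: "k = l" if "2 * k mod p = 2 * l mod p" "k \<in> {1..p - 1}" "l \<in> {1..p - 1}" for k l
  proof -
    have "p dvd 2 * (k - l)"
      using that by (simp add: mod_eq_dvd_iff right_diff_distrib)
    \<comment> \<open>Numbers in \<open>{1..p - 1}\<close> are their own residues, so the congruence
      becomes an equality.\<close>
    then have "k mod p = l mod p"
      by (simp only: two mod_eq_dvd_iff)
    then show ?thesis
      using that by simp
  qed
  have "inj_on (double_mod p) (recip_index p)"
    by (rule inj_onI) (auto simp: double_mod_def recip_index_iff split: prod.splits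
        intro: inj simp del: atLeastAtMost_iff)
  moreover have "double_mod p ` recip_index p \<subseteq> recip_index p"
    by (auto simp: double_mod_def recip_index_iff norm range simp del: atLeastAtMost_iff)
  ultimately show ?thesis
    by (simp add: bij_betw_def endo_inj_surj finite_recip_index)
qed

lemma sum_inverse_orbit_prod:
  assumes "p > 5"
  obtains t where "t \<in> gauss_local p" "(\<Sum>x\<in>recip_index p. 1 / orbit_prod p x) = of_int p * t"
proof -
  let ?D = "recip_index p" and ?P = "orbit_prod p" and ?d = "double_mod p"
  define B where "B = (\<Sum>x\<in>?D. 1 / ?P x)"
  have bij: "bij_betw ?d ?D ?D"
    using assms by (intro bij_double_mod) simp
  have "\<exists>s\<in>gauss_local p. 1 / ?P x - 16 * (1 / ?P (?d x)) = of_int p * s" if x: "x \<in> ?D" for x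
  proof -
    have dx: "?d x \<in> ?D"
      using bij x by (auto simp: bij_betw_def)
    obtain s where s: "s \<in> gauss_local p" "?P (?d x) - 16 * ?P x = of_int p * s"
      using orbit_prod_double_mod[of x] unfolding gauss_cong_def by auto
    \<comment> \<open>The congruence between orbit products passes to their reciprocals because
      these are \<open>p\<close>-integral by \<open>inverse_orbit_prod\<close>.\<close>
    have "1 / ?P x - 16 * (1 / ?P (?d x)) = (?P (?d x) - 16 * ?P x) * ((1 / ?P x) * (1 / ?P (?d x)))"
      using inverse_orbit_prod(1)[OF x] inverse_orbit_prod(1)[OF dx] by (simp add: field_simps)
    also have "\<dots> = of_int p * (s * ((1 / ?P x) * (1 / ?P (?d x))))"
      by (simp add: s(2))
    finally show ?thesis
      using gauss_local_mult[OF p] s(1) inverse_orbit_prod(2)[OF x] inverse_orbit_prod(2)[OF dx]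
      by blast
  qed
  then obtain s where s: "\<And>x. x \<in> ?D \<Longrightarrow> s x \<in> gauss_local p"
    "\<And>x. x \<in> ?D \<Longrightarrow> 1 / ?P x - 16 * (1 / ?P (?d x)) = of_int p * s x"
    by metis
  have "B - 16 * (\<Sum>x\<in>?D. 1 / ?P (?d x)) = of_int p * sum s ?D"
    unfolding B_def by (simp only: sum_distrib_left s(2) flip: sum_subtractf cong: sum.cong)
  moreover have "(\<Sum>x\<in>?D. 1 / ?P (?d x)) = B"
    unfolding B_def by (rule sum.reindex_bij_betw[OF bij])
  \<comment> \<open>Reindexing by the doubling map gives B - 16 B on the left, whence the factor
    -15.\<close>
  ultimately have "of_int p * sum s ?D = B * of_int (- 15)"
    by (simp add: algebra_simps)
  then have "B = of_int p * (sum s ?D / of_int (- 15))"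
    by simp
  then have "(\<Sum>x\<in>?D. 1 / ?P x) = of_int p * (sum s ?D / of_int (- 15))"
    by (simp only: B_def)
  \<comment> \<open>Here p > 5 enters: it excludes both prime factors 3 and 5 of 15.\<close>
  moreover have "\<not> p dvd - 15"
  proof
    assume "p dvd - 15"
    then have "p dvd 3 * 5" by simp
    then have "p dvd 3 \<or> p dvd 5"
      using p prime_dvd_mult_iff by blast
    then show False
      using assms zdvd_imp_le[of p 3] zdvd_imp_le[of p 5] by auto
  qed
  then have "sum s ?D / of_int (- 15) \<in> gauss_local p"
    by (intro gauss_local_divide_int[OF p] gauss_local_sum[OF p] s(1))
  ultimately show thesis
    by (rule that[rotated])
qed

end

theorem theorem1:
  fixes p :: int
  assumes "prime p" and "p > 5"
  shows "gauss_cong p 4 (gauss_recip_sum p) 0"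
proof -
  note p = assms(1)
  obtain t where t: "t \<in> gauss_local p"
    "(\<Sum>x\<in>recip_index p. 1 / orbit_prod p x) = of_int p * t"
    using sum_inverse_orbit_prod[OF assms] .
  \<comment> \<open>The orbit identity supplies p^3 (i - 1) and the divisibility of the sum of
    inverse orbit products supplies p t; the 4 undoes the fourfold count.\<close>
  define z where "z = (\<i> - of_int 1) * t / of_int 4"
  have "\<not> p dvd 4"
    using assms zdvd_imp_le[of p 4] by auto
  then have z: "z \<in> gauss_local p"
    unfolding z_def using t(1) gauss_local_i[OF p] gauss_local_of_int[OF p]
    by (intro gauss_local_divide_int[OF p] gauss_local_mult[OF p] gauss_local_diff[OF p])
  have "4 * gauss_recip_sum p = 4 * (of_int p ^ 4 * z)"
    unfolding gauss_recip_sum_orbit[OF p] t(2) z_def by (simp add: eval_nat_numeral)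
  then have S: "gauss_recip_sum p = of_int p ^ 4 * z"
    by simp
  \<comment> \<open>Membership of the sum itself in the local ring, which \<open>gauss_cong\<close>
    demands, is read off from its closed form.\<close>
  have "of_int p ^ 4 * z \<in> gauss_local p"
    using gauss_local_mult[OF p gauss_local_of_int[OF p] z, of "p ^ 4"] by simp
  then show ?thesis
    unfolding gauss_cong_def S using z gauss_local_0[OF p] by auto
qed

end
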